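(* Let $\kappa$ be an infinite regular cardinal, let $\mathfrak{L}$ be a $\kappa$-complete lower semi-lattice, let $\Gamma$ be a group of automorphisms of $\mathfrak{L}$, and let $\mathfrak{F}=\{f_a : a\in A\}$, with $A\neq\varnothing$, be a $\Gamma$-close-knit family in $\mathfrak{L}$. Then $\Gamma$ has a fixed point in $\mathfrak{L}$, i.e. there is $n\in\mathfrak{L}$ with $\gamma n=n$ for all $\gamma\in\Gamma$.
   Context: A lower semi-lattice $\mathfrak{L}$ is a partially ordered set in which any two elements $s,t$ have a meet (infimum) $s\wedge t$. It is $\kappa$-complete if every non-empty sub-family of size $<\kappa$ admits an infimum. Automorphisms of $\mathfrak{L}$ are order automorphisms. "Closed under finite meet" refers to meets of non-empty finite subsets, and the sets $S$ below are non-empty. Close-knit families. The following data are given: - A $\kappa$-complete lower semi-lattice $\mathfrak{L}$, for a regular cardinal $\kappa$. - A family $\mathfrak{F}=\{f_a : a\in A\}\subseteq\mathfrak{L}$, where the enumeration may have repetitions. - A compact Hausdorff topological space $\mathfrak{I}$ equipped with a partial order $\le$ that is closed as a subset of $\mathfrak{I}\times\mathfrak{I}$. Put $\lambda = w(\mathfrak{I})^+ + \aleph_0$, where $w(\mathfrak{I})$ is the weight of $\mathfrak{I}$ (the least cardinality of an open basis) and $w(\mathfrak{I})^+$ is its successor cardinal. It is required that $\kappa\geq\lambda$. - A map $\delta\colon\mathfrak{L}\times A\to\mathfrak{I}$. - A map $\mathfrak{F}_\kappa\times A\to\mathfrak{L}$, denoted $(s,a)\mapsto s^a$, where $\mathfrak{F}_\kappa\subseteq\mathfrak{L}$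 is the family of meets of (non-empty sets of) $<\kappa$ elements of $\mathfrak{F}$. Similarly, $\mathfrak{F}_\lambda$ is the family of meets of (non-empty sets of) $<\lambda$ elements of $\mathfrak{F}$. The family $\mathfrak{F}$ (together with these data) is close-knit if: 1. $\delta$ is monotone in its first argument ($t\le s$ implies $\delta(t,a)\le\delta(s,a)$) and "upper semi-continuous" in it, in the sense that if $S\subseteq\mathfrak{L}$ is closed under finite meet and $|S|<\kappa$, then $\delta(\bigwedge S,a)=\bigwedge\{\delta(s,a):s\in S\}$ (infimum in $\mathfrak{I}$) for all $a\in A$. 2. Let $\xi\in\mathfrak{I}$ and let $S\subseteq\mathfrak{L}$ be closed under finite meet with $|S|<\kappa$. Assume that for every neighbourhood $U\subseteq\mathfrak{I}$ of $\xi$ and every $s\in S$ there exist $\zeta\in U$ and $a\in A$ such that $\delta(s,a)\geq\zeta$. Then there exists $a\in A$ satisfying $\delta(s,a)\geq\xi$ for all $s\in S$. 3. For all $s\in\mathfrak{F}_\kappa$ and $a\in A$ we have $s\le s^a$, and whenever $t\le s$ are in $\mathfrak{F}_\kappa$ with $\delta(t,a)=\delta(s,a)$, then $t^a=s^a$. 4. For any $s\in\mathfrak{F}_\lambda$ there is a cardinal $\mu_s<\kappa$ such that for all $a\in A$, any chain in $\mathfrak{L}$ between $s$ and $s^a$ (i.e. any totally ordered subset of $\{x\in\mathfrak{L}: s\le x\le s^a\}$) has cardinality $<\mu_s$. If $\Gamma$ is a group of automorphisms of $\mathfrak{L}$ which also acts on the index set $A$, and all the data are invariant under $\Gamma$,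 that is, $f_{\gamma a}=\gamma f_a$, $\delta(\gamma s,\gamma a)=\delta(s,a)$ and $(\gamma s)^{\gamma a}=\gamma(s^a)$ for all $\gamma\in\Gamma$, then $\mathfrak{F}$ is called a $\Gamma$-close-knit family. *)

theory Defs
  imports
    "HOL-Analysis.Elementary_Topology"
    "HOL-Algebra.Group_Action"
    "HOL-Library.Lub_Glb"
begin

unbundle cardinal_syntax

text \<open>
  Cardinals are represented, as in the library, by minimal well-orders \<open>r :: 'k rel\<close> with
  \<open>Card_order r\<close>.  The poset \<open>L\<close>, the index set \<open>A\<close> and the compact ordered space \<open>I\<close> are the
  universes of the types \<open>'l\<close>, \<open>'a\<close> and \<open>'i\<close>.
\<close>

definition weight :: "'i::topological_space itself \<Rightarrow> 'i set rel" where
  "weight _ = |SOME B :: 'i set set. topological_basis B \<and>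
     (\<forall>B' :: 'i set set. topological_basis B' \<longrightarrow> |B| \<le>o |B'| )|"

lemma weight_exists:
  "\<exists>B :: 'i::topological_space set set. topological_basis B \<and>
     (\<forall>B' :: 'i set set. topological_basis B' \<longrightarrow> |B| \<le>o |B'| )"
proof -
  let ?R = "card_of ` {B :: 'i set set. topological_basis B}"
  have "topological_basis (Collect open :: 'i set set)"
    unfolding topological_basis_def by (auto intro: exI[of _ "{_}"])
  then have "?R \<noteq> {}" by blast
  moreover have "\<forall>r\<in>?R. Card_order r" by (auto intro: card_of_Card_order)
  ultimately show ?thesis
    using exists_minim_Card_order[of ?R] by auto
qed

lemma weight_basis:
  obtains B :: "'i::topological_space set set"
  where "topological_basis B" "weight TYPE('i) = |B|"
    "\<And>B' :: 'i set set. topological_basis B' \<Longrightarrow> |B| \<le>o |B'|"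
  using someI_ex[OF weight_exists] unfolding weight_def by blast

definition lambda_card :: "'i::topological_space itself \<Rightarrow> ('i set set + nat) rel" where
  "lambda_card _ = cardSuc (weight TYPE('i)) +c natLeq"

definition card_complete :: "'k rel \<Rightarrow> 'l::semilattice_inf itself \<Rightarrow> bool" where
  "card_complete \<kappa> _ \<longleftrightarrow>
     (\<forall>S :: 'l set. S \<noteq> {} \<and> |S| <o \<kappa> \<longrightarrow> (\<exists>m. isGlb UNIV S m))"

definition meets :: "'c rel \<Rightarrow> ('a \<Rightarrow> 'l::semilattice_inf) \<Rightarrow> 'l set" where
  "meets \<mu> f = {m. \<exists>S \<subseteq> range f. S \<noteq> {} \<and> |S| <o \<mu> \<and> isGlb UNIV S m}"

definition closed_under_finite_meet :: "'l::semilattice_inf set \<Rightarrow> bool" where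
  "closed_under_finite_meet S \<longleftrightarrow>
     (\<forall>T. T \<subseteq> S \<and> finite T \<and> T \<noteq> {} \<longrightarrow> Inf_fin T \<in> S)"

text \<open>
  \<open>ext s a\<close> stands for \<open>s\<^sup>a\<close>; it is a total function of which only the values at
  \<open>s \<in> meets \<kappa> f\<close> are ever constrained or used.
  In \<open>ext_chains\<close>, every cardinal below \<open>\<kappa>\<close> is represented by a relation on the type \<open>'k\<close>
  underlying \<open>\<kappa>\<close>, so quantifying \<open>\<mu>\<close> over \<open>'k rel\<close> loses nothing.
\<close>

locale close_knit_family =
  fixes \<kappa> :: "'k rel"
    and f :: "'a \<Rightarrow> 'l::semilattice_inf"
    and \<delta> :: "'l \<Rightarrow> 'a \<Rightarrow> 'i::{t2_space, order}"
    and ext :: "'l \<Rightarrow> 'a \<Rightarrow> 'l"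
  assumes compact_space: "compact (UNIV :: 'i set)"
    and closed_order: "closed {(x :: 'i, y). x \<le> y}"
    and lambda_le: "lambda_card TYPE('i) \<le>o \<kappa>"
    and delta_mono: "t \<le> s \<Longrightarrow> \<delta> t a \<le> \<delta> s a"
    and delta_semicont:
      "\<lbrakk>S \<noteq> {}; closed_under_finite_meet S; |S| <o \<kappa>; isGlb UNIV S m\<rbrakk>
        \<Longrightarrow> isGlb UNIV ((\<lambda>s. \<delta> s a) ` S) (\<delta> m a)"
    and delta_realised:
      "\<lbrakk>S \<noteq> {}; closed_under_finite_meet S; |S| <o \<kappa>;
        \<forall>U. \<xi> \<in> interior U \<longrightarrow> (\<forall>s\<in>S. \<exists>\<zeta>\<in>U. \<exists>a. \<zeta> \<le> \<delta> s a)\<rbrakk>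
        \<Longrightarrow> \<exists>a. \<forall>s\<in>S. \<xi> \<le> \<delta> s a"
    and ext_ge: "s \<in> meets \<kappa> f \<Longrightarrow> s \<le> ext s a"
    and ext_eq:
      "\<lbrakk>s \<in> meets \<kappa> f; t \<in> meets \<kappa> f; t \<le> s; \<delta> t a = \<delta> s a\<rbrakk> \<Longrightarrow> ext t a = ext s a"
    and ext_chains:
      "s \<in> meets (lambda_card TYPE('i)) f \<Longrightarrow>
        \<exists>\<mu> :: 'k rel. Card_order \<mu> \<and> \<mu> <o \<kappa> \<and>
          (\<forall>a C. C \<subseteq> {s..ext s a} \<and> Complete_Partial_Order.chain (\<le>) C \<longrightarrow> |C| <o \<mu>)"

definition automorphism_group :: "('l::order \<Rightarrow> 'l) set \<Rightarrow> bool" where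
  "automorphism_group \<Gamma> \<longleftrightarrow>
     subgroup \<Gamma> (BijGroup UNIV) \<and> (\<forall>\<gamma>\<in>\<Gamma>. \<forall>x y. \<gamma> x \<le> \<gamma> y \<longleftrightarrow> x \<le> y)"

text \<open>
  The action of \<open>\<Gamma>\<close> on the index set is a separate datum \<open>act\<close>; it need not be determined by
  the action on \<open>L\<close>, since the enumeration \<open>f\<close> may have repetitions.
\<close>

locale gamma_close_knit_family = close_knit_family \<kappa> f \<delta> ext
  for \<kappa> :: "'k rel"
    and f :: "'a \<Rightarrow> 'l::semilattice_inf"
    and \<delta> :: "'l \<Rightarrow> 'a \<Rightarrow> 'i::{t2_space, order}"
    and ext :: "'l \<Rightarrow> 'a \<Rightarrow> 'l" +
  fixes \<Gamma> :: "('l \<Rightarrow> 'l) set"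
    and act :: "('l \<Rightarrow> 'l) \<Rightarrow> 'a \<Rightarrow> 'a"
  assumes automorphisms: "automorphism_group \<Gamma>"
    and index_action: "group_action (BijGroup UNIV\<lparr>carrier := \<Gamma>\<rparr>) UNIV act"
    and f_equivariant: "\<gamma> \<in> \<Gamma> \<Longrightarrow> f (act \<gamma> a) = \<gamma> (f a)"
    and delta_invariant: "\<gamma> \<in> \<Gamma> \<Longrightarrow> \<delta> (\<gamma> s) (act \<gamma> a) = \<delta> s a"
    and ext_equivariant:
      "\<lbrakk>\<gamma> \<in> \<Gamma>; s \<in> meets \<kappa> f\<rbrakk> \<Longrightarrow> ext (\<gamma> s) (act \<gamma> a) = \<gamma> (ext s a)"

end

theory Submission
  imports Defs "HOL-Algebra.Free_Abelian_Groups"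
begin

text \<open>
  The fixed point is the common value that infima attached to the meets of the family take at all
  sufficiently small meets.  The automorphisms permute the meets and respect the infima, so they
  cannot move this value.  The pattern is that of Schlichting's theorem on uniformly commensurable
  subgroups.

  Write \<open>D(s)\<close> (\<open>realised\<close> in the formal text) for the set of all \<open>\<xi>\<close> below some
  \<open>\<delta> s a\<close>.  The axiom that locally realised values are realised
  makes \<open>D(s)\<close> closed, and \<open>D(s)\<close> shrinks with \<open>s\<close>.  As the topology has a basis of size \<open>w\<close>, at
  most \<open>w\<close> finite meets of the family exclude all the values that finite meets can exclude; their
  common meet \<open>s\<close> is a meet of fewer than \<open>\<lambda>\<close> members, and semicontinuity shows that
  \<open>D(s) \<subseteq> D(t)\<close> for every \<open>t\<close> in \<open>meets \<kappa> f\<close> (\<open>realised_minimal\<close>).  By compactness \<open>D(s)\<close> has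
  a maximal element \<open>\<xi>\<close> (\<open>settled_exists\<close>).

  For \<open>t \<le> s\<close> let \<open>A\<^sub>t\<close> (\<open>attaining \<xi> t\<close>) be the set of the \<open>a\<close> with \<open>\<xi> \<le> \<delta> t a\<close>.
  It is non-empty by minimality
  of \<open>D(s)\<close>, it shrinks with \<open>t\<close>, and maximality of \<open>\<xi>\<close> gives \<open>\<delta> t a = \<xi> = \<delta> s a\<close> on it, hence
  \<open>ext t a = ext s a\<close>.  So a smaller \<open>t\<close> only discards some of the elements \<open>ext s a\<close>, and
  \<open>n\<^sub>t\<close>, the infimum of the \<open>ext t a\<close> with \<open>a \<in> A\<^sub>t\<close>, can only increase as \<open>t\<close> decreases.  The
  bound on chains between \<open>s\<close> and \<open>ext s a\<close> is used twice.  It makes the infimum \<open>n\<^sub>t\<close> exist, even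
  though \<open>A\<^sub>t\<close> may be large (\<open>glb_exists_if_chains_short\<close>).  And since fewer than \<open>\<kappa>\<close> of the
  \<open>n\<^sub>t\<close> always lie below a common \<open>ext s a\<close>, the uniformity of the bound in \<open>a\<close> makes \<open>n\<^sub>t\<close>
  reach a final value \<open>n\<close> (\<open>stable_glb_exists\<close>).

  Two settled elements have a common lower bound, namely their meet.  Therefore the final value
  does not depend on where one starts, and each \<open>\<gamma>\<close>, which carries \<open>n\<^sub>t\<close> to the
  infimum at \<open>\<gamma> t\<close>, fixes it (\<open>stable_glb_fixed\<close>).
\<close>

section \<open>Maximal elements\<close>

lemma maximal_if_chains_bounded:
  fixes A :: "'b::order set"
  assumes "\<And>C. C \<subseteq> A \<Longrightarrow> Complete_Partial_Order.chain (\<le>) C \<Longrightarrow> \<exists>u\<in>A. \<forall>x\<in>C. x \<le> u"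
  shows "\<exists>m\<in>A. \<forall>x\<in>A. m \<le> x \<longrightarrow> x = m"
proof (rule predicate_Zorn)
  show "partial_order_on A (relation_of (\<le>) A)"
    by (rule partial_order_on_relation_ofI) auto
  fix C assume "C \<in> Chains (relation_of (\<le>) A)"
  then have "C \<subseteq> A" "Complete_Partial_Order.chain (\<le>) C"
    by (auto simp: Chains_def relation_of_def Complete_Partial_Order.chain_def)
  then show "\<exists>u\<in>A. \<forall>x\<in>C. x \<le> u" by (rule assms)
qed

lemma minimal_if_chains_bounded:
  fixes A :: "'b::order set"
  assumes "\<And>C. C \<subseteq> A \<Longrightarrow> Complete_Partial_Order.chain (\<le>) C \<Longrightarrow> \<exists>u\<in>A. \<forall>x\<in>C. u \<le> x"
  shows "\<exists>m\<in>A. \<forall>x\<in>A. x \<le> m \<longrightarrow> x = m"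
proof (rule predicate_Zorn)
  show "partial_order_on A (relation_of (\<ge>) A)"
    by (rule partial_order_on_relation_ofI) auto
  fix C assume "C \<in> Chains (relation_of (\<ge>) A)"
  then have "C \<subseteq> A" "Complete_Partial_Order.chain (\<le>) C"
    by (auto simp: Chains_def relation_of_def Complete_Partial_Order.chain_def)
  then show "\<exists>u\<in>A. \<forall>x\<in>C. u \<le> x" by (rule assms)
qed

text \<open>
  Zorn's lemma applies because the upper bounds of a single point form a closed set: a chain is
  bounded by the finite intersection property.
\<close>

lemma compact_pospace_maximal:
  fixes V :: "'i::{t2_space, order} set"
  assumes "compact (UNIV :: 'i set)" and "closed {(x :: 'i, y). x \<le> y}"
    and "closed V" and "V \<noteq> {}"
  shows "\<exists>m\<in>V. \<forall>x\<in>V. m \<le> x \<longrightarrow> x = m"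
proof (rule maximal_if_chains_bounded)
  fix C assume C: "C \<subseteq> V" "Complete_Partial_Order.chain (\<le>) C"
  have up: "closed {y. x \<le> y}" for x :: 'i
  proof -
    have "closed ((\<lambda>y. (x, y)) -` {(x, y). x \<le> y})"
      by (rule closed_vimage[OF assms(2)]) (auto intro!: continuous_intros)
    then show ?thesis by (simp add: vimage_def)
  qed
  have top: "\<exists>y\<in>V. \<forall>x\<in>F. x \<le> y" if F: "finite F" "F \<subseteq> C" for F
  proof (cases "F = {}")
    case False
    then obtain y where y: "y \<in> F" "\<forall>x\<in>F. y \<le> x \<longrightarrow> y = x"
      using finite_has_maximal[OF F(1)] by blast
    then have "\<forall>x\<in>F. x \<le> y"
      using F(2) C(2) by (metis Complete_Partial_Order.chain_def order_refl subsetD)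
    then show ?thesis using y(1) F(2) C(1) by blast
  qed (use assms(4) in auto)
  have "V \<inter> (\<Inter>x\<in>C. {y. x \<le> y}) \<noteq> {}"
  proof (rule compact_imp_fip_image)
    show "compact V" using compact_Int_closed[OF assms(1,3)] by simp
    show "V \<inter> (\<Inter>x\<in>F. {y. x \<le> y}) \<noteq> {}" if "finite F" "F \<subseteq> C" for F
      using top[OF that] by auto
  qed (rule up)
  then show "\<exists>u\<in>V. \<forall>x\<in>C. x \<le> u" by auto
qed

section \<open>Meets of small families\<close>

lemma isGlb_iff:
  "isGlb UNIV S m \<longleftrightarrow> (\<forall>x\<in>S. m \<le> x) \<and> (\<forall>y. (\<forall>x\<in>S. y \<le> x) \<longrightarrow> y \<le> m)"
  by (auto simp: isGlb_def greatestP_def isLb_def setle_def setge_def)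

lemma isGlb_UNION:
  fixes m :: "'b \<Rightarrow> 'l::order"
  assumes "\<And>i. i \<in> I \<Longrightarrow> isGlb UNIV (Y i) (m i)" and "isGlb UNIV (m ` I) u"
  shows "isGlb UNIV (\<Union>i\<in>I. Y i) u"
  unfolding isGlb_iff
proof (intro conjI allI impI ballI)
  fix x assume "x \<in> (\<Union>i\<in>I. Y i)"
  then obtain i where i: "i \<in> I" "x \<in> Y i" by blast
  then have "u \<le> m i" using assms(2) by (simp add: isGlb_iff)
  also have "m i \<le> x" using assms(1) i by (simp add: isGlb_iff)
  finally show "u \<le> x" .
next
  fix y assume "\<forall>x\<in>\<Union>i\<in>I. Y i. y \<le> x"
  then have "y \<le> m i" if "i \<in> I" for i using assms(1)[OF that] that by (simp add: isGlb_iff)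
  then show "y \<le> u" using assms(2) by (simp add: isGlb_iff)
qed

lemma finite_ordLess_Cinfinite:
  assumes "finite S" "Card_order \<kappa>" "cinfinite \<kappa>"
  shows "|S| <o \<kappa>"
  using assms by (intro Cfinite_ordLess_Cinfinite) (auto simp: cfinite_def card_of_Card_order)

text \<open>
  The conditions on \<open>\<delta>\<close> speak of sets closed under finite meets; closing a set in this way
  changes neither its infimum nor, relative to an infinite cardinal, its smallness.
\<close>

definition finite_meets :: "'l::semilattice_inf set \<Rightarrow> 'l set" where
  "finite_meets S = {Inf_fin T |T. T \<subseteq> S \<and> finite T \<and> T \<noteq> {}}"

lemma finite_meets_closed: "closed_under_finite_meet (finite_meets S)"
proof -
  have two: "inf x y \<in> finite_meets S" if xy: "x \<in> finite_meets S" "y \<in> finite_meets S" for x y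
  proof -
    obtain T U where TU: "x = Inf_fin T" "T \<subseteq> S" "finite T" "T \<noteq> {}"
      "y = Inf_fin U" "U \<subseteq> S" "finite U" "U \<noteq> {}"
      using xy by (auto simp: finite_meets_def)
    then have "inf x y = Inf_fin (T \<union> U)" by (simp add: Inf_fin.union)
    then show ?thesis using TU unfolding finite_meets_def by blast
  qed
  have "Inf_fin T \<in> finite_meets S" if "finite T" "T \<noteq> {}" "T \<subseteq> finite_meets S" for T
    using that by (induction T rule: finite_ne_induct) (auto simp: Inf_fin.insert intro: two)
  then show ?thesis unfolding closed_under_finite_meet_def by blast
qed

lemma subset_finite_meets: "S \<subseteq> finite_meets S"
  unfolding finite_meets_def by (auto intro!: exI[of _ "{_}"])

lemma finite_meets_isGlb_iff: "isGlb UNIV (finite_meets S) m \<longleftrightarrow> isGlb UNIV S m"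
proof -
  have "(\<forall>x\<in>finite_meets S. y \<le> x) \<longleftrightarrow> (\<forall>x\<in>S. y \<le> x)" for y
  proof
    show "\<forall>x\<in>S. y \<le> x" if "\<forall>x\<in>finite_meets S. y \<le> x"
      using that subset_finite_meets by blast
    show "\<forall>x\<in>finite_meets S. y \<le> x" if "\<forall>x\<in>S. y \<le> x"
      using that by (auto simp: finite_meets_def intro!: Inf_fin.boundedI)
  qed
  then show ?thesis unfolding isGlb_iff by simp
qed

lemma card_finite_meets:
  assumes "|S| <o \<kappa>" "Card_order \<kappa>" "cinfinite \<kappa>"
  shows "|finite_meets S| <o \<kappa>"
proof -
  have img: "finite_meets S \<subseteq> Inf_fin ` Fpow S"
    by (auto simp: finite_meets_def Fpow_def)
  show ?thesis
  proof (cases "finite S")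
    case True
    then have "finite (finite_meets S)"
      using img by (auto simp: Fpow_def intro: finite_subset)
    then show ?thesis using assms finite_ordLess_Cinfinite by blast
  next
    case False
    have "|finite_meets S| \<le>o |Fpow S|"
      using img surj_imp_ordLeq by blast
    also have "|Fpow S| =o |S|" using False by (rule card_of_Fpow_infinite)
    finally show ?thesis using assms(1) by (rule ordLeq_ordLess_trans)
  qed
qed

text \<open>
  Regularity of \<open>\<kappa>\<close> enters here: fewer than \<open>\<kappa>\<close> sets of size less than \<open>\<kappa>\<close> have a union of size
  less than \<open>\<kappa>\<close>.
\<close>

lemma meets_memI:
  assumes "Card_order \<kappa>" "cinfinite \<kappa>" "regularCard \<kappa>"
    and "S \<subseteq> meets \<kappa> f" "S \<noteq> {}" "|S| <o \<kappa>" "isGlb UNIV S m"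
  shows "m \<in> meets \<kappa> f"
proof -
  have "\<forall>s\<in>S. \<exists>Y. Y \<subseteq> range f \<and> Y \<noteq> {} \<and> |Y| <o \<kappa> \<and> isGlb UNIV Y s"
    using assms(4) by (auto simp: meets_def)
  then obtain Y where Y: "\<And>s. s \<in> S \<Longrightarrow> Y s \<subseteq> range f \<and> Y s \<noteq> {} \<and> |Y s| <o \<kappa> \<and> isGlb UNIV (Y s) s"
    by metis
  have "|\<Union>s\<in>S. Y s| <o \<kappa>"
    using assms Y by (intro regularCard_UNION_bound) auto
  moreover have "isGlb UNIV (\<Union>s\<in>S. Y s) m"
    using Y assms(7) by (intro isGlb_UNION[where m = "\<lambda>s. s"]) auto
  moreover have "(\<Union>s\<in>S. Y s) \<subseteq> range f" using Y by blast
  moreover have "(\<Union>s\<in>S. Y s) \<noteq> {}" using Y assms(5) by auto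
  ultimately show ?thesis
    unfolding meets_def by (intro CollectI exI[of _ "\<Union>s\<in>S. Y s"] conjI)
qed

lemma meets_inf:
  assumes "Card_order \<kappa>" "cinfinite \<kappa>" "regularCard \<kappa>" "s \<in> meets \<kappa> f" "t \<in> meets \<kappa> f"
  shows "inf s t \<in> meets \<kappa> f"
  using assms
  by (intro meets_memI[of \<kappa> "{s, t}"]) (auto simp: isGlb_iff intro: finite_ordLess_Cinfinite)

lemma meets_mono: "\<mu> \<le>o \<kappa> \<Longrightarrow> meets \<mu> f \<subseteq> meets \<kappa> f"
  unfolding meets_def by (blast intro: ordLess_ordLeq_trans)

text \<open>
  The set \<open>X\<close> may have \<open>\<kappa>\<close> or more elements.  Among the infima of its small subsets that contain
  \<open>x0\<close>, all of which lie between \<open>s\<close> and \<open>x0\<close>, Zorn's lemma finds a minimal one: a chain of them is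
  short, so that completeness and regularity bound it by another infimum of a small subset.
  Adding one more element of \<open>X\<close> does not lower the minimal infimum, so it bounds all of \<open>X\<close>.
\<close>

lemma glb_exists_if_chains_short:
  fixes X :: "'l::semilattice_inf set"
  assumes reg: "Card_order \<kappa>" "cinfinite \<kappa>" "regularCard \<kappa>"
    and complete: "card_complete \<kappa> TYPE('l)"
    and x0: "x0 \<in> X" and s: "\<And>x. x \<in> X \<Longrightarrow> s \<le> x"
    and short: "\<And>C. C \<subseteq> {s..x0} \<Longrightarrow> Complete_Partial_Order.chain (\<le>) C \<Longrightarrow> |C| <o \<kappa>"
  shows "\<exists>m. isGlb UNIV X m"
proof -
  define M where "M = {m. \<exists>Y\<subseteq>X. x0 \<in> Y \<and> |Y| <o \<kappa> \<and> isGlb UNIV Y m}"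
  have M: "M \<subseteq> {s..x0}"
    using s by (fastforce simp: M_def isGlb_iff)
  have "\<exists>m\<in>M. \<forall>x\<in>M. x \<le> m \<longrightarrow> x = m"
  proof (rule minimal_if_chains_bounded)
    fix C assume C: "C \<subseteq> M" "Complete_Partial_Order.chain (\<le>) C"
    show "\<exists>u\<in>M. \<forall>x\<in>C. u \<le> x"
    proof (cases "C = {}")
      case True
      have "x0 \<in> M"
        unfolding M_def using x0 reg
        by (auto simp: isGlb_iff intro!: exI[of _ "{x0}"] finite_ordLess_Cinfinite)
      then show ?thesis using True by auto
    next
      case False
      have "\<forall>c\<in>C. \<exists>Y. Y \<subseteq> X \<and> x0 \<in> Y \<and> |Y| <o \<kappa> \<and> isGlb UNIV Y c"
        using C(1) by (auto simp: M_def)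
      then obtain Y where Y: "\<And>c. c \<in> C \<Longrightarrow> Y c \<subseteq> X \<and> x0 \<in> Y c \<and> |Y c| <o \<kappa> \<and> isGlb UNIV (Y c) c"
        by metis
      have "|C| <o \<kappa>" using short C M by blast
      then have card: "|\<Union>c\<in>C. Y c| <o \<kappa>"
        using reg Y by (intro regularCard_UNION_bound) auto
      moreover have "(\<Union>c\<in>C. Y c) \<noteq> {}" using False Y by blast
      ultimately obtain u where u: "isGlb UNIV (\<Union>c\<in>C. Y c) u"
        using complete unfolding card_complete_def by blast
      have "u \<in> M"
      proof -
        have "(\<Union>c\<in>C. Y c) \<subseteq> X" using Y by blast
        moreover have "x0 \<in> (\<Union>c\<in>C. Y c)" using Y False by auto
        ultimately show ?thesis unfolding M_def using u card by (intro CollectI exI[of _ "\<Union>c\<in>C. Y c"] conjI)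
      qed
      moreover have "u \<le> c" if c: "c \<in> C" for c
      proof -
        have "\<forall>y\<in>Y c. u \<le> y" using u c by (simp add: isGlb_iff)
        then show ?thesis using Y[OF c] by (simp add: isGlb_iff)
      qed
      ultimately show ?thesis by blast
    qed
  qed
  then obtain m where m: "m \<in> M" "\<And>x. x \<in> M \<Longrightarrow> x \<le> m \<Longrightarrow> x = m" by blast
  obtain Y where Y: "Y \<subseteq> X" "x0 \<in> Y" "|Y| <o \<kappa>" "isGlb UNIV Y m"
    using m(1) by (auto simp: M_def)
  have "m \<le> x" if x: "x \<in> X" for x
  proof -
    have "|Y \<union> {x}| <o \<kappa>"
      using Y(3) reg finite_ordLess_Cinfinite[of "{x}" \<kappa>]
      by (intro card_of_Un_ordLess_infinite_Field) (auto simp: cinfinite_def)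
    then have "inf m x \<in> M"
      unfolding M_def using Y x
      by (intro CollectI exI[of _ "Y \<union> {x}"]) (auto simp: isGlb_iff intro: le_infI1)
    then have "inf m x = m" using m(2) by simp
    then show ?thesis by (simp add: inf.absorb_iff1)
  qed
  moreover have "y \<le> m" if "\<forall>x\<in>X. y \<le> x" for y
    using Y(1,4) that by (simp add: isGlb_iff subset_iff)
  ultimately show ?thesis by (auto simp: isGlb_iff)
qed


section \<open>Elements at which a maximal value is settled\<close>

context gamma_close_knit_family
begin

definition realised :: "'l \<Rightarrow> 'i set" where
  "realised s = {\<xi>. \<exists>a. \<xi> \<le> \<delta> s a}"

definition attaining :: "'i \<Rightarrow> 'l \<Rightarrow> 'a set" where
  "attaining \<xi> s = {a. \<xi> \<le> \<delta> s a}"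

text \<open>
  Maximality of \<open>\<xi>\<close>, in a form that passes to all smaller meets and is invariant under
  automorphisms.  It turns the inequality \<open>\<xi> \<le> \<delta> s a\<close> into the equality of values under
  which \<open>ext\<close> does not change.
\<close>

definition settled :: "'i \<Rightarrow> 'l \<Rightarrow> bool" where
  "settled \<xi> s \<longleftrightarrow> s \<in> meets \<kappa> f \<and> (\<forall>a\<in>attaining \<xi> s. \<delta> s a = \<xi>)"

definition extensions :: "'i \<Rightarrow> 'l \<Rightarrow> 'l set" where
  "extensions \<xi> s = ext s ` attaining \<xi> s"

lemma realised_antimono: "t \<le> s \<Longrightarrow> realised t \<subseteq> realised s"
  unfolding realised_def using delta_mono order_trans by blast

lemma attaining_antimono: "t \<le> s \<Longrightarrow> attaining \<xi> t \<subseteq> attaining \<xi> s"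
  unfolding attaining_def using delta_mono order_trans by blast

lemma settled_below:
  assumes "settled \<xi> s" "t \<in> meets \<kappa> f" "t \<le> s"
  shows "settled \<xi> t"
proof -
  have "\<delta> t a = \<xi>" if a: "a \<in> attaining \<xi> t" for a
  proof (rule antisym)
    have "a \<in> attaining \<xi> s" using attaining_antimono[OF assms(3)] a by blast
    then have "\<delta> s a = \<xi>" using assms(1) by (simp add: settled_def)
    then show "\<delta> t a \<le> \<xi>" using delta_mono[OF assms(3)] by metis
  qed (use a in \<open>simp add: attaining_def\<close>)
  then show ?thesis using assms(2) by (simp add: settled_def)
qed

lemma ext_settled_below:
  assumes "settled \<xi> s" "t \<in> meets \<kappa> f" "t \<le> s" "a \<in> attaining \<xi> t"
  shows "ext t a = ext s a"
proof (rule ext_eq)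
  have "\<delta> t a = \<xi>"
    using settled_below[OF assms(1-3)] assms(4) by (simp add: settled_def)
  moreover have "\<delta> s a = \<xi>"
    using assms(1,4) attaining_antimono[OF assms(3)] by (auto simp: settled_def)
  ultimately show "\<delta> t a = \<delta> s a" by simp
qed (use assms in \<open>auto simp: settled_def\<close>)

text \<open>
  Passing to a smaller element discards indices but changes no extension at the remaining ones;
  hence the infimum of the extensions can only go up.
\<close>

lemma extensions_antimono:
  assumes "settled \<xi> s" "t \<in> meets \<kappa> f" "t \<le> s"
  shows "extensions \<xi> t \<subseteq> extensions \<xi> s"
  using ext_settled_below[OF assms] attaining_antimono[OF assms(3)]
  unfolding extensions_def by fastforce

section \<open>Equivariance\<close>

lemma
  assumes "\<gamma> \<in> \<Gamma>"
  shows automorphism_bij: "bij \<gamma>"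
    and automorphism_le_iff: "\<gamma> x \<le> \<gamma> y \<longleftrightarrow> x \<le> y"
    and automorphism_inv: "inv_into UNIV \<gamma> \<in> \<Gamma>"
    and act_surj: "surj (act \<gamma>)"
proof -
  have sub: "subgroup \<Gamma> (BijGroup UNIV)"
    and le: "\<forall>\<gamma>\<in>\<Gamma>. \<forall>x y. \<gamma> x \<le> \<gamma> y \<longleftrightarrow> x \<le> y"
    using automorphisms unfolding automorphism_group_def by auto
  have carrier: "\<gamma> \<in> carrier (BijGroup UNIV)" using subgroup.mem_carrier[OF sub assms] .
  then show "bij \<gamma>" by (simp add: BijGroup_def Bij_def)
  show "\<gamma> x \<le> \<gamma> y \<longleftrightarrow> x \<le> y" using le assms by blast
  have "inv\<^bsub>BijGroup UNIV\<^esub> \<gamma> = inv_into UNIV \<gamma>"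
    using inv_BijGroup[of \<gamma> UNIV] carrier by (simp add: BijGroup_def restrict_def)
  then show "inv_into UNIV \<gamma> \<in> \<Gamma>" using subgroup.m_inv_closed[OF sub assms] by simp
  have "act \<gamma> \<in> carrier (BijGroup UNIV)"
    using index_action assms
    unfolding group_action_def group_hom_def group_hom_axioms_def hom_def by auto
  then show "surj (act \<gamma>)" by (simp add: BijGroup_def Bij_def bij_betw_def)
qed

lemma automorphism_isGlb:
  assumes "\<gamma> \<in> \<Gamma>" "isGlb UNIV X m"
  shows "isGlb UNIV (\<gamma> ` X) (\<gamma> m)"
  unfolding isGlb_iff
proof (intro conjI allI impI)
  show "\<forall>y\<in>\<gamma> ` X. \<gamma> m \<le> y"
    using assms automorphism_le_iff by (auto simp: isGlb_iff)
  fix y assume y: "\<forall>x\<in>\<gamma> ` X. y \<le> x"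
  obtain z where "y = \<gamma> z" using automorphism_bij[OF assms(1)] by (metis bij_pointE)
  then show "y \<le> \<gamma> m" using y assms automorphism_le_iff by (auto simp: isGlb_iff)
qed

lemma automorphism_meets:
  assumes \<gamma>: "\<gamma> \<in> \<Gamma>" and "s \<in> meets \<kappa> f"
  shows "\<gamma> s \<in> meets \<kappa> f"
proof -
  obtain S where S: "S \<subseteq> range f" "S \<noteq> {}" "|S| <o \<kappa>" "isGlb UNIV S s"
    using assms(2) by (auto simp: meets_def)
  have "\<gamma> (f a) \<in> range f" for a
    using f_equivariant[OF \<gamma>] by (metis rangeI)
  then have "\<gamma> ` S \<subseteq> range f" using S(1) by auto
  moreover have "|\<gamma> ` S| <o \<kappa>" using card_of_image S(3) by (rule ordLeq_ordLess_trans)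
  ultimately show ?thesis
    using S(2) automorphism_isGlb[OF \<gamma> S(4)] unfolding meets_def by blast
qed

lemma attaining_equivariant:
  assumes "\<gamma> \<in> \<Gamma>"
  shows "attaining \<xi> (\<gamma> s) = act \<gamma> ` attaining \<xi> s"
proof -
  have "a \<in> act \<gamma> ` attaining \<xi> s" if "a \<in> attaining \<xi> (\<gamma> s)" for a
  proof -
    obtain b where "a = act \<gamma> b" using act_surj[OF assms] by (metis surjD)
    then show ?thesis using that delta_invariant[OF assms] by (auto simp: attaining_def)
  qed
  then show ?thesis using delta_invariant[OF assms] by (auto simp: attaining_def)
qed

lemma settled_equivariant:
  assumes "\<gamma> \<in> \<Gamma>" "settled \<xi> s"
  shows "settled \<xi> (\<gamma> s)"
  using assms automorphism_meets delta_invariant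
  by (auto simp: settled_def attaining_equivariant)

lemma extensions_equivariant:
  assumes "\<gamma> \<in> \<Gamma>" "s \<in> meets \<kappa> f"
  shows "extensions \<xi> (\<gamma> s) = \<gamma> ` extensions \<xi> s"
  unfolding extensions_def attaining_equivariant[OF assms(1)] image_image
  using ext_equivariant[OF assms] by simp

text \<open>
  The infimum \<open>\<beta> n\<close> of the extensions of \<open>\<beta> s\<close> is below that of the smaller element
  \<open>inf s (\<beta> s)\<close>, which is \<open>n\<close> by stability.  Applied to \<open>\<gamma>\<close> and to its inverse, \<open>\<beta> n \<le> n\<close> gives
  equality.
\<close>

lemma stable_glb_fixed:
  assumes inf: "\<And>s t. s \<in> meets \<kappa> f \<Longrightarrow> t \<in> meets \<kappa> f \<Longrightarrow> inf s t \<in> meets \<kappa> f"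
    and s: "settled \<xi> s"
    and stable: "\<And>t. t \<in> meets \<kappa> f \<Longrightarrow> t \<le> s \<Longrightarrow> isGlb UNIV (extensions \<xi> t) n"
    and \<gamma>: "\<gamma> \<in> \<Gamma>"
  shows "\<gamma> n = n"
proof -
  have s_meet: "s \<in> meets \<kappa> f" using s by (simp add: settled_def)
  have below: "\<beta> n \<le> n" if \<beta>: "\<beta> \<in> \<Gamma>" for \<beta>
  proof -
    let ?t = "inf s (\<beta> s)"
    have t: "?t \<in> meets \<kappa> f" using inf s_meet automorphism_meets[OF \<beta>] by blast
    have "extensions \<xi> ?t \<subseteq> extensions \<xi> (\<beta> s)"
      using extensions_antimono[OF settled_equivariant[OF \<beta> s] t] by simp
    moreover have "isGlb UNIV (extensions \<xi> (\<beta> s)) (\<beta> n)"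
      unfolding extensions_equivariant[OF \<beta> s_meet]
      using automorphism_isGlb[OF \<beta> stable[OF s_meet order_refl]] .
    moreover have "isGlb UNIV (extensions \<xi> ?t) n" using stable[OF t] by simp
    ultimately show ?thesis unfolding isGlb_iff by blast
  qed
  have "\<gamma> (inv_into UNIV \<gamma> n) \<le> \<gamma> n"
    using below[OF automorphism_inv[OF \<gamma>]] automorphism_le_iff[OF \<gamma>] by blast
  then have "n \<le> \<gamma> n"
    using automorphism_bij[OF \<gamma>] by (simp add: bij_is_surj surj_f_inv_f)
  then show ?thesis using below[OF \<gamma>] by (rule antisym[rotated])
qed

section \<open>A smallest set of realised values\<close>

context
  assumes reg: "Card_order \<kappa>" "cinfinite \<kappa>" "regularCard \<kappa>"
    and complete: "card_complete \<kappa> TYPE('l)"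
begin

text \<open>
  A point of the closure is realised in every neighbourhood, so the realisation axiom for the set
  \<open>{s}\<close> provides an index for the point itself.
\<close>

lemma realised_closed: "closed (realised s)"
proof -
  have "\<xi> \<in> realised s" if \<xi>: "\<xi> \<in> closure (realised s)" for \<xi>
  proof -
    have "\<exists>a. \<forall>s'\<in>{s}. \<xi> \<le> \<delta> s' a"
    proof (rule delta_realised)
      show "closed_under_finite_meet {s}"
        unfolding closed_under_finite_meet_def by (auto simp: subset_singleton_iff)
      show "|{s}| <o \<kappa>" using reg by (intro finite_ordLess_Cinfinite) auto
      have "\<exists>\<zeta>\<in>U. \<exists>a. \<zeta> \<le> \<delta> s a" if "\<xi> \<in> interior U" for U
      proof -
        have "realised s \<inter> U \<noteq> {}"
          using \<xi> that interior_subset open_interior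
          unfolding closure_iff_nhds_not_empty by metis
        then show ?thesis by (auto simp: realised_def)
      qed
      then show "\<forall>U. \<xi> \<in> interior U \<longrightarrow> (\<forall>s'\<in>{s}. \<exists>\<zeta>\<in>U. \<exists>a. \<zeta> \<le> \<delta> s' a)" by simp
    qed simp
    then show ?thesis by (simp add: realised_def)
  qed
  then show ?thesis using closure_subset_eq by blast
qed

text \<open>
  Finite meets already decide which values are realised.  The realisation axiom gives one index
  that works for all finite meets of a small family, and semicontinuity carries the inequality
  to their infimum.
\<close>

lemma realised_meet:
  assumes t: "t \<in> meets \<kappa> f" and \<xi>: "\<And>s. s \<in> finite_meets (range f) \<Longrightarrow> \<xi> \<in> realised s"
  shows "\<xi> \<in> realised t"
proof -
  obtain S where S: "S \<subseteq> range f" "S \<noteq> {}" "|S| <o \<kappa>" "isGlb UNIV S t"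
    using t by (auto simp: meets_def)
  let ?F = "finite_meets S"
  have F: "?F \<noteq> {}" "closed_under_finite_meet ?F" "|?F| <o \<kappa>" "isGlb UNIV ?F t"
    using S subset_finite_meets[of S] finite_meets_closed card_finite_meets[OF S(3) reg(1,2)]
    by (auto simp: finite_meets_isGlb_iff)
  have "?F \<subseteq> finite_meets (range f)"
    using S(1) unfolding finite_meets_def by blast
  then have att: "\<exists>a. \<xi> \<le> \<delta> s a" if "s \<in> ?F" for s
    using that \<xi>[of s] by (auto simp: realised_def)
  have "\<exists>a. \<forall>s\<in>?F. \<xi> \<le> \<delta> s a"
  proof (rule delta_realised[OF F(1-3)], intro allI impI ballI)
    fix U s assume "\<xi> \<in> interior U" "s \<in> ?F"
    then show "\<exists>\<zeta>\<in>U. \<exists>a. \<zeta> \<le> \<delta> s a"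
      using att interior_subset[of U] by (intro bexI[of _ \<xi>]) auto
  qed
  then obtain a where "\<forall>s\<in>?F. \<xi> \<le> \<delta> s a" ..
  moreover have "isGlb UNIV ((\<lambda>s. \<delta> s a) ` ?F) (\<delta> t a)"
    using F by (rule delta_semicont)
  ultimately have "\<xi> \<le> \<delta> t a" by (simp add: isGlb_iff)
  then show ?thesis by (auto simp: realised_def)
qed

text \<open>
  A value outside the closed set of a finite meet has a basic neighbourhood \<open>U\<close> disjoint from it.  It
  is enough to choose, for each \<open>U\<close> in a smallest basis, one finite meet that excludes all of \<open>U\<close>,
  if there is one.  The members of the family involved in these choices are fewer than \<open>\<lambda>\<close>, and
  this is the reason for the size of \<open>\<lambda>\<close>.
\<close>

lemma realised_minimal:
  "\<exists>s\<in>meets (lambda_card TYPE('i)) f. \<forall>t\<in>meets \<kappa> f. realised s \<subseteq> realised t"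
proof -
  let ?L = "lambda_card TYPE('i)"
  obtain B :: "'i set set" where B: "topological_basis B" "weight TYPE('i) = |B|"
    by (rule weight_basis, rule that)
  have suc: "Card_order (cardSuc |B| )" by (simp add: cardSuc_Card_order card_of_Card_order)
  have L: "Card_order ?L" "cinfinite ?L"
    using Cinfinite_csum[of "cardSuc (weight TYPE('i))" natLeq] natLeq_Cinfinite
    unfolding lambda_card_def by simp_all
  have "|B| <o ?L"
  proof -
    have "|B| <o cardSuc |B|" by (simp add: cardSuc_greater card_of_Card_order)
    also have "cardSuc |B| \<le>o ?L"
      unfolding lambda_card_def B(2) using suc by (rule ordLeq_csum1)
    finally show ?thesis .
  qed
  define P where "P = (\<lambda>U T. T \<subseteq> range f \<and> finite T \<and> T \<noteq> {} \<and> realised (Inf_fin T) \<inter> U = {})"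
  have "\<exists>T'. finite T' \<and> T' \<subseteq> range f \<and> (\<forall>T. P U T \<longrightarrow> P U T')" for U
  proof (cases "\<exists>T. P U T")
    case True
    then obtain T where "P U T" ..
    then show ?thesis by (intro exI[of _ T]) (simp add: P_def)
  qed (auto intro!: exI[of _ "{}"])
  then obtain \<tau> where \<tau>_fin: "\<And>U. finite (\<tau> U)" "\<And>U. \<tau> U \<subseteq> range f"
    and \<tau>: "\<And>U T. P U T \<Longrightarrow> P U (\<tau> U)"
    by metis
  \<comment> \<open>The extra point keeps \<open>S\<close> non-empty when no basic set is ever excluded.\<close>
  define S where "S = (\<Union>U\<in>B. \<tau> U) \<union> {f undefined}"
  have "|\<Union>U\<in>B. \<tau> U| <o ?L"
  proof (cases "finite B")
    case True
    then show ?thesis using \<tau>_fin L by (intro finite_ordLess_Cinfinite) auto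
  next
    case False
    then have "|\<Union>U\<in>B. \<tau> U| \<le>o |B|"
      using \<tau>_fin(1) by (intro card_of_UNION_ordLeq_infinite) (auto intro: ordLess_imp_ordLeq finite_ordLess_infinite2)
    then show ?thesis using \<open>|B| <o ?L\<close> by (rule ordLeq_ordLess_trans)
  qed
  then have S_card: "|S| <o ?L"
    unfolding S_def using L finite_ordLess_Cinfinite[of "{f undefined}" ?L]
    by (intro card_of_Un_ordLess_infinite_Field) (auto simp: cinfinite_def)
  have S: "S \<noteq> {}" "S \<subseteq> range f" using \<tau>_fin(2) by (auto simp: S_def)
  obtain s where s: "isGlb UNIV S s"
    using complete S(1) ordLess_ordLeq_trans[OF S_card lambda_le]
    unfolding card_complete_def by metis
  have "realised s \<subseteq> realised r" if r: "r \<in> finite_meets (range f)" for r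
  proof (rule ccontr)
    assume "\<not> realised s \<subseteq> realised r"
    then obtain \<xi> where \<xi>: "\<xi> \<in> realised s" "\<xi> \<in> - realised r" by auto
    have "open (- realised r)" using realised_closed by (simp add: open_Compl)
    then obtain U where U: "U \<in> B" "\<xi> \<in> U" "U \<subseteq> - realised r"
      using topological_basisE[OF B(1) _ \<xi>(2)] by metis
    obtain T where "T \<subseteq> range f" "finite T" "T \<noteq> {}" "r = Inf_fin T"
      using r by (auto simp: finite_meets_def)
    then have "P U T" using U(3) by (auto simp: P_def)
    then have PU: "P U (\<tau> U)" by (rule \<tau>)
    have "s \<le> Inf_fin (\<tau> U)"
    proof (rule Inf_fin.boundedI)
      show "s \<le> x" if "x \<in> \<tau> U" for x
        using s that U(1) unfolding isGlb_iff S_def by blast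
    qed (use PU in \<open>auto simp: P_def\<close>)
    then have "\<xi> \<in> realised (Inf_fin (\<tau> U))" using \<xi>(1) realised_antimono by blast
    then show False using PU U(2) by (auto simp: P_def)
  qed
  then have "\<forall>t\<in>meets \<kappa> f. realised s \<subseteq> realised t"
    using realised_meet by blast
  moreover have "s \<in> meets ?L f"
    using S S_card s unfolding meets_def by blast
  ultimately show ?thesis by blast
qed

lemma settled_exists:
  "\<exists>\<xi>. \<exists>s\<in>meets (lambda_card TYPE('i)) f.
     settled \<xi> s \<and> (\<forall>t\<in>meets \<kappa> f. attaining \<xi> t \<noteq> {})"
proof -
  obtain s where s: "s \<in> meets (lambda_card TYPE('i)) f"
    "\<And>t. t \<in> meets \<kappa> f \<Longrightarrow> realised s \<subseteq> realised t"
    using realised_minimal by blast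
  have "realised s \<noteq> {}" by (auto simp: realised_def)
  then obtain \<xi> where \<xi>: "\<xi> \<in> realised s" "\<And>\<zeta>. \<zeta> \<in> realised s \<Longrightarrow> \<xi> \<le> \<zeta> \<Longrightarrow> \<zeta> = \<xi>"
    using compact_pospace_maximal[OF compact_space closed_order realised_closed] by metis
  have "\<delta> s a \<in> realised s" for a by (auto simp: realised_def)
  then have "settled \<xi> s"
    using \<xi>(2) s(1) meets_mono[OF lambda_le] by (auto simp: settled_def attaining_def)
  moreover have "attaining \<xi> t \<noteq> {}" if "t \<in> meets \<kappa> f" for t
    using s(2)[OF that] \<xi>(1) by (auto simp: realised_def attaining_def)
  ultimately show ?thesis using s(1) by blast
qed

section \<open>Stabilisation of the infimum\<close>

text \<open>
  Zorn's lemma gives a maximal infimum, which no smaller element can increase.  The point is that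
  chains of infima are bounded.  A family of fewer than \<open>\<kappa>\<close> of them, taken at elements \<open>t c\<close>, is
  bounded by the infimum at the meet of the \<open>t c\<close>, and that one lies below some \<open>ext s a\<close>.  A chain of
  \<open>\<mu>\<close> or more infima would contain one of size exactly \<open>\<mu> < \<kappa>\<close>, which would thus lie in a single
  interval from \<open>s\<close> to \<open>ext s a\<close>; there every chain has size less than \<open>\<mu>\<close>.
\<close>

lemma stable_glb_exists:
  assumes s: "s \<in> meets (lambda_card TYPE('i)) f" "settled \<xi> s"
    and att: "\<And>t. t \<in> meets \<kappa> f \<Longrightarrow> attaining \<xi> t \<noteq> {}"
  shows "\<exists>t n. settled \<xi> t \<and>
    (\<forall>u\<in>meets \<kappa> f. u \<le> t \<longrightarrow> isGlb UNIV (extensions \<xi> u) n)"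
proof -
  obtain \<mu> :: "'k rel" where \<mu>: "Card_order \<mu>" "\<mu> <o \<kappa>"
    "\<And>a C. C \<subseteq> {s..ext s a} \<Longrightarrow> Complete_Partial_Order.chain (\<le>) C \<Longrightarrow> |C| <o \<mu>"
    using ext_chains[OF s(1)] by blast
  have s_meet: "s \<in> meets \<kappa> f" using s(2) by (simp add: settled_def)
  have ext_s: "\<exists>a. x = ext s a" "s \<le> x"
    if "x \<in> extensions \<xi> t" "t \<in> meets \<kappa> f" "t \<le> s" for x t
    using extensions_antimono[OF s(2) that(2,3)] that(1) ext_ge[OF s_meet]
    by (auto simp: extensions_def)
  have glb: "\<exists>n. isGlb UNIV (extensions \<xi> t) n" if t: "t \<in> meets \<kappa> f" "t \<le> s" for t
  proof -
    obtain x where x: "x \<in> extensions \<xi> t" using att[OF t(1)] by (auto simp: extensions_def)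
    then obtain a where "x = ext s a" using ext_s t by blast
    then show ?thesis
      using \<mu>(3)[of _ a] \<mu>(2) ext_s t
      by (intro glb_exists_if_chains_short[OF reg complete x, of s])
        (auto intro: ordLess_transitive)
  qed
  define N where "N = {n. \<exists>t\<in>meets \<kappa> f. t \<le> s \<and> isGlb UNIV (extensions \<xi> t) n}"
  have bound: "\<exists>a. \<exists>n\<in>N. n \<le> ext s a \<and> (\<forall>c\<in>C. s \<le> c \<and> c \<le> n)"
    if C: "C \<subseteq> N" "|C| <o \<kappa>" for C
  proof -
    have "\<forall>c\<in>C. \<exists>t. t \<in> meets \<kappa> f \<and> t \<le> s \<and> isGlb UNIV (extensions \<xi> t) c"
      using C(1) by (auto simp: N_def)
    then obtain t where t: "\<And>c. c \<in> C \<Longrightarrow> t c \<in> meets \<kappa> f \<and> t c \<le> s \<and> isGlb UNIV (extensions \<xi> (t c)) c"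
      by metis
    \<comment> \<open>Adding \<open>s\<close> keeps the set non-empty when \<open>C\<close> is empty, and the meet below \<open>s\<close>.\<close>
    let ?T = "t ` C \<union> {s}"
    have "|t ` C| <o \<kappa>" using card_of_image C(2) by (rule ordLeq_ordLess_trans)
    then have T_card: "|?T| <o \<kappa>"
      using reg finite_ordLess_Cinfinite[of "{s}" \<kappa>]
      by (intro card_of_Un_ordLess_infinite_Field) (auto simp: cinfinite_def)
    then obtain u where u: "isGlb UNIV ?T u"
      using complete unfolding card_complete_def by blast
    have u_meet: "u \<in> meets \<kappa> f"
      using t s_meet by (intro meets_memI[OF reg _ _ T_card u]) auto
    have us: "u \<le> s" using u by (simp add: isGlb_iff)
    obtain n where n: "isGlb UNIV (extensions \<xi> u) n" using glb u_meet us by blast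
    have "n \<in> N" using n u_meet us by (auto simp: N_def)
    obtain x where x: "x \<in> extensions \<xi> u" using att[OF u_meet] by (auto simp: extensions_def)
    then obtain a where "x = ext s a" using ext_s u_meet us by blast
    moreover have "n \<le> x" using n x by (auto simp: isGlb_iff)
    moreover have "s \<le> c \<and> c \<le> n" if c: "c \<in> C" for c
    proof
      show "s \<le> c" using t[OF c] ext_s(2)[of _ "t c"] unfolding isGlb_iff by blast
      have "u \<le> t c" using u c by (auto simp: isGlb_iff)
      then have "extensions \<xi> u \<subseteq> extensions \<xi> (t c)"
        using t[OF c] settled_below[OF s(2)] by (intro extensions_antimono u_meet) auto
      then show "c \<le> n" using t[OF c] n unfolding isGlb_iff by blast
    qed
    ultimately show ?thesis using \<open>n \<in> N\<close> by blast
  qed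
  have "\<exists>n\<in>N. \<forall>x\<in>N. n \<le> x \<longrightarrow> x = n"
  proof (rule maximal_if_chains_bounded)
    fix C assume C: "C \<subseteq> N" "Complete_Partial_Order.chain (\<le>) C"
    have "|C| <o \<mu>"
    proof (rule ccontr)
      assume "\<not> |C| <o \<mu>"
      then have "\<mu> \<le>o |C|"
        using \<mu>(1) ordLess_or_ordLeq[of "|C|" \<mu>] card_of_Well_order[of C]
        unfolding card_order_on_def by blast
      then have "|Field \<mu>| \<le>o |C|"
        using \<mu>(1) card_of_Field_ordIso ordIso_ordLeq_trans by blast
      then obtain g where g: "inj_on g (Field \<mu>)" "g ` Field \<mu> \<subseteq> C"
        unfolding card_of_ordLeq[symmetric] by blast
      let ?D = "g ` Field \<mu>"
      have D_card: "|?D| =o \<mu>"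
        using g(1) card_of_Field_ordIso[OF \<mu>(1)]
        by (meson card_of_ordIsoI inj_on_imp_bij_betw ordIso_symmetric ordIso_transitive)
      then have "|?D| <o \<kappa>" using \<mu>(2) by (rule ordIso_ordLess_trans)
      then obtain a n where n: "n \<le> ext s a" "\<forall>c\<in>?D. s \<le> c \<and> c \<le> n"
        using bound[of ?D] g(2) C(1) by blast
      then have "?D \<subseteq> {s..ext s a}" by fastforce
      moreover have "Complete_Partial_Order.chain (\<le>) ?D"
        using C(2) g(2) by (auto simp: Complete_Partial_Order.chain_def)
      ultimately have "|?D| <o \<mu>" by (rule \<mu>(3))
      then show False using D_card not_ordLess_ordIso by blast
    qed
    then have "|C| <o \<kappa>" using \<mu>(2) by (rule ordLess_transitive)
    then show "\<exists>n\<in>N. \<forall>c\<in>C. c \<le> n" using bound[OF C(1)] by metis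
  qed
  then obtain n where n: "n \<in> N" "\<And>x. x \<in> N \<Longrightarrow> n \<le> x \<Longrightarrow> x = n" by blast
  then obtain t where t: "t \<in> meets \<kappa> f" "t \<le> s" "isGlb UNIV (extensions \<xi> t) n"
    by (auto simp: N_def)
  have settled_t: "settled \<xi> t" using settled_below[OF s(2)] t by blast
  have "isGlb UNIV (extensions \<xi> u) n" if u: "u \<in> meets \<kappa> f" "u \<le> t" for u
  proof -
    have us: "u \<le> s" using u(2) t(2) by (rule order_trans)
    obtain m where m: "isGlb UNIV (extensions \<xi> u) m" using glb u(1) us by blast
    then have "m \<in> N" using u(1) us by (auto simp: N_def)
    moreover have "n \<le> m"
      using m t(3) extensions_antimono[OF settled_t u] unfolding isGlb_iff by blast
    ultimately show ?thesis using n(2) m by blast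
  qed
  then show ?thesis using settled_t by blast
qed

end

end

theorem theorem1p2:
  fixes \<kappa> :: "'k rel"
    and f :: "'a \<Rightarrow> 'l::semilattice_inf"
    and \<delta> :: "'l \<Rightarrow> 'a \<Rightarrow> 'i::{t2_space, order}"
    and ext :: "'l \<Rightarrow> 'a \<Rightarrow> 'l"
    and \<Gamma> :: "('l \<Rightarrow> 'l) set"
    and act :: "('l \<Rightarrow> 'l) \<Rightarrow> 'a \<Rightarrow> 'a"
  assumes "Card_order \<kappa>" and "cinfinite \<kappa>" and "regularCard \<kappa>"
    and "card_complete \<kappa> TYPE('l)"
    and "automorphism_group \<Gamma>"
    and "gamma_close_knit_family \<kappa> f \<delta> ext \<Gamma> act"
  shows "\<exists>n :: 'l. \<forall>\<gamma>\<in>\<Gamma>. \<gamma> n = n"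
proof -
  interpret gamma_close_knit_family \<kappa> f \<delta> ext \<Gamma> act by fact
  note hyps = assms(1-4)
  obtain \<xi> s where s: "s \<in> meets (lambda_card TYPE('i)) f" "settled \<xi> s"
    and att: "\<And>t. t \<in> meets \<kappa> f \<Longrightarrow> attaining \<xi> t \<noteq> {}"
    using settled_exists[OF hyps] by blast
  obtain t n where t: "settled \<xi> t"
    "\<And>u. u \<in> meets \<kappa> f \<Longrightarrow> u \<le> t \<Longrightarrow> isGlb UNIV (extensions \<xi> u) n"
    using stable_glb_exists[OF hyps s att] by blast
  have "\<gamma> n = n" if "\<gamma> \<in> \<Gamma>" for \<gamma>
    using meets_inf[OF assms(1-3)] t that by (rule stable_glb_fixed)
  then show ?thesis by blast
qed

end
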